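(* Let $F$ be a finite field, and let $H$ be a subgroup of $F^\times$ such that $H$ lies entirely within a proper subfield of $F$. Let $\chi\colon H\to\mathbb{C}^\times$ be any character of $H$. Then $(F,\chi)$ does not have the strong uncertainty property.
   Context: Let $F=\mathbb{F}_q$ be the finite field of order $q$ and characteristic $p$, with absolute trace $\operatorname{Tr}\colon\mathbb{F}_q\to\mathbb{F}_p$. Let $\epsilon(x)=\exp(2\pi i\operatorname{Tr}(x)/p)$ and, for $a\in\mathbb{F}_q$, $\epsilon_a(x)=\epsilon(ax)$. Then $\widehat{\mathbb{F}}_q=\{\epsilon_a:a\in\mathbb{F}_q\}$ is the group of all additive characters $\mathbb{F}_q\to\mathbb{C}^\times$ ($\epsilon_0$ is trivial). $\mathbb{C}[\mathbb{F}_q]$ is the group ring of the additive group; its elements $f=\sum_{a\in\mathbb{F}_q}f_a[a]$ are identified with functions $a\mapsto f(a)=f_a$, and $\operatorname{supp}(f)=\{a:f_a\ne0\}$. The Fourier transform of $f$ is $\widehat f\colon\widehat{\mathbb{F}}_q\to\mathbb{C}$, $\widehat f(\psi)=\sum_a f_a\psi(a)$, with support $\{\psi:\widehat f(\psi)\neq0\}$. A character of $H$ is a group homomorphism $\chi\colon H\to\mathbb{C}^\times$ (trivial if identically $1$). An element $f\in\mathbb{C}[\mathbb{F}_q]$ is $\chi$-symmetric if $f_{ha}=\chi(h)f_a$ for all $h\in H$, $a\in\mathbb{F}_q$. $(\mathbb{F}_q,\chi)$ has the strong uncertainty property if every nonzero $\chi$-symmetric $f\in\mathbb{C}[\mathbb{F}_q]$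 satisfies: if $\chi$ is nontrivial, $|\operatorname{supp}(f)|+|\operatorname{supp}(\widehat f)|\ge q+|H|-1$; if $\chi$ is trivial, $|\operatorname{supp}(f)|+|\operatorname{supp}(\widehat f)|$ is at least $q+2|H|-1$ if $f(0)=0$ and $\widehat f(\epsilon_0)=0$, at least $q+|H|$ if exactly one of $f(0)$, $\widehat f(\epsilon_0)$ is $0$, and at least $q+1$ otherwise. *)

theory Defs
  imports "HOL-Algebra.Algebraic_Closure_Type" "HOL-Algebra.Sylow"
    "HOL-Library.Cardinality" "HOL-Number_Theory.Cong" Complex_Main
begin

text \<open>
  The field with \<open>q\<close> elements is a type \<open>'a\<close> of class \<open>finite_field\<close>, so \<open>q = CARD('a)\<close>
  and \<open>p = CHAR('a)\<close>. The record \<open>ring_of_type_algebra\<close> is only used to refer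
  to the subfields of \<open>'a\<close> and to the groups of units of \<open>'a\<close> and \<open>complex\<close>.
\<close>

lemma finite_field_card_eq:
  "CARD('a :: finite_field) = CHAR('a) ^ multiplicity CHAR('a) CARD('a)"
proof -
  define p q where "p = CHAR('a)" and "q = CARD('a)"
  have p: "prime p" unfolding p_def by simp
  have q: "q > 0" unfolding q_def by simp
  interpret A: ring "ring_of_type_algebra :: 'a ring" by rule
  let ?G = "add_monoid (ring_of_type_algebra :: 'a ring)"
  have carG: "carrier ?G = UNIV" and multG: "monoid.mult ?G = (+)" and oneG: "one ?G = 0"
    by (auto simp: ring_of_type_algebra_def fun_eq_iff)
  have pow: "x [^]\<^bsub>?G\<^esub> n = of_nat n * x" for x :: 'a and n :: nat
    by (induction n) (simp_all add: ring_of_type_algebra_def algebra_simps)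
  have only_p: "r = p" if r: "prime r" "r dvd q" for r
  proof (rule ccontr)
    assume ne: "r \<noteq> p"
    obtain m where m: "q = r ^ 1 * m" using r(2) by (auto elim: dvdE)
    have "\<exists>H. subgroup H ?G \<and> card H = r ^ 1"
    proof (rule sylow_thm)
      show "group ?G" by (rule A.add.group_axioms)
      show "Coset.order ?G = r ^ 1 * m" unfolding Coset.order_def carG using m q_def by simp
      show "finite (carrier ?G)" unfolding carG by simp
    qed (fact r(1))
    then obtain H where H: "subgroup H ?G" "card H = r" by auto
    have "card H > 1" using prime_gt_1_nat[OF r(1)] H(2) by simp
    moreover have "H \<subseteq> {0}"
    proof
      fix x assume x: "x \<in> H"
      interpret H: group "?G\<lparr>carrier := H\<rparr>" by (rule A.add.subgroup_imp_group[OF H(1)])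
      have "x [^]\<^bsub>?G\<lparr>carrier := H\<rparr>\<^esub> Coset.order (?G\<lparr>carrier := H\<rparr>) = one (?G\<lparr>carrier := H\<rparr>)"
        by (rule H.pow_order_eq_1) (use x in simp)
      moreover have "Coset.order (?G\<lparr>carrier := H\<rparr>) = r" "one (?G\<lparr>carrier := H\<rparr>) = 0"
        using H(2) oneG by (simp_all add: Coset.order_def)
      ultimately have "x [^]\<^bsub>?G\<lparr>carrier := H\<rparr>\<^esub> r = 0" by (simp only:)
      hence "x [^]\<^bsub>?G\<^esub> r = 0" 
        using monoid.nat_pow_consistent[OF A.add.monoid_axioms, of x r H] by (rule trans[rotated])
      hence "of_nat r * x = 0" by (simp only: pow)
      moreover have "of_nat r \<noteq> (0 :: 'a)"
        unfolding of_nat_eq_0_iff_char_dvd using ne primes_dvd_imp_eq[OF p r(1)] by (auto simp: p_def)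
      ultimately show "x \<in> {0}" by simp
    qed
    ultimately show False
      using card_mono[of "{0}" H] by simp
  qed
  obtain k where k: "q = p ^ multiplicity p q * k" "\<not> p dvd k"
    using multiplicity_decompose'[of q p] p q by (metis mult.commute not_prime_unit neq0_conv)
  have "k = 1"
    using k only_p by (metis dvd_triv_right dvd_trans prime_factor_nat)
  thus ?thesis using k unfolding p_def q_def by simp
qed

text \<open>
  The absolute trace, as an element of \<open>'a\<close> that lies in the prime field (see below);
  the sum runs over the conjugates \<open>x, x\<^sup>p, \<dots>\<close>, with \<open>q = p\<^sup>n\<close>
  and \<open>n = multiplicity p q\<close>.
\<close>
definition abs_trace :: "'a :: finite_field \<Rightarrow> 'a" where
  "abs_trace x = (\<Sum>i < multiplicity CHAR('a) CARD('a). x ^ (CHAR('a) ^ i))"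

lemma abs_trace_in_prime_field:
  "\<exists>k < CHAR('a). abs_trace (x :: 'a :: finite_field) = of_nat k"
proof -
  let ?p = "CHAR('a)" and ?n = "multiplicity CHAR('a) CARD('a)"
  let ?t = "abs_trace x"
  have p: "prime ?p" by simp
  have "?t ^ ?p = (\<Sum>i<?n. (x ^ (?p ^ i)) ^ ?p)"
    unfolding abs_trace_def by (rule freshmans_dream_sum) auto
  also have "\<dots> = (\<Sum>i<?n. x ^ (?p ^ Suc i))"
    by (simp add: mult.commute flip: power_mult)
  also have "\<dots> = (\<Sum>i<Suc ?n. x ^ (?p ^ i)) - x"
    unfolding sum.lessThan_Suc_shift by simp
  also have "\<dots> = ?t"
    using finite_field_card_eq[where ?'a = 'a] finite_field_power_card_eq_same[of x]
    unfolding abs_trace_def by simp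
  finally have t: "?t ^ ?p = ?t" .
  let ?P = "monom 1 ?p - monom 1 1 :: 'a poly"
  have p1: "?p > 1" using p by (rule prime_gt_1_nat)
  have "coeff ?P ?p = 1" using p1 by simp
  hence P0: "?P \<noteq> 0" by (metis coeff_0 zero_neq_one)
  have deg: "degree ?P \<le> ?p"
    using p1 by (intro degree_diff_le) (auto simp: degree_monom_eq)
  have sub: "of_nat ` {..<?p} \<subseteq> {y. poly ?P y = 0}"
  proof -
    have "(of_nat k :: 'a) ^ ?p = of_nat k" for k
      using freshmans_dream_sum[of ?p "\<lambda>_. 1 :: 'a" "{..<k}"] by simp
    thus ?thesis by (auto simp: poly_monom)
  qed
  have "card (of_nat ` {..<?p} :: 'a set) = ?p"
    by (subst card_image) (auto intro!: inj_onI simp: of_nat_eq_iff_cong_CHAR cong_def)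
  hence "of_nat ` {..<?p} = {y. poly ?P y = 0}"
    using card_poly_roots_bound[OF P0] deg sub poly_roots_finite[OF P0]
    by (intro card_seteq) auto
  moreover have "poly ?P ?t = 0" using t by (simp add: poly_monom)
  ultimately show ?thesis by auto
qed

text \<open>
  \<open>\<epsilon>(x) = exp(2\<pi>i Tr(x)/p)\<close>; the exponent only depends on \<open>Tr(x)\<close> modulo \<open>p\<close>, and
  \<open>LEAST\<close> picks the representative of \<open>Tr(x)\<close> in \<open>{0..<p}\<close>.
\<close>
definition std_char :: "'a :: finite_field \<Rightarrow> complex" where
  "std_char x =
     exp (2 * of_real pi * \<i> * of_nat (LEAST k. of_nat k = abs_trace x) / of_nat CHAR('a))"

definition add_char :: "'a :: finite_field \<Rightarrow> 'a \<Rightarrow> complex" where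
  "add_char a x = std_char (a * x)"

definition dual :: "('a :: finite_field \<Rightarrow> complex) set" where
  "dual = range add_char"

text \<open>Elements of the group ring \<open>\<complex>[F]\<close> are identified with functions on \<open>F\<close>.\<close>

definition supp :: "('a :: finite_field \<Rightarrow> complex) \<Rightarrow> 'a set" where
  "supp f = {a. f a \<noteq> 0}"

definition fourier :: "('a :: finite_field \<Rightarrow> complex) \<Rightarrow> ('a \<Rightarrow> complex) \<Rightarrow> complex" where
  "fourier f \<psi> = (\<Sum>a\<in>UNIV. f a * \<psi> a)"

definition fourier_supp :: "('a :: finite_field \<Rightarrow> complex) \<Rightarrow> ('a \<Rightarrow> complex) set" where
  "fourier_supp f = {\<psi> \<in> dual. fourier f \<psi> \<noteq> 0}"

text \<open>
  Group characters of a subgroup \<open>H\<close> of the unit group; only the values on \<open>H\<close> are relevant.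
\<close>
definition characters :: "'a :: finite_field set \<Rightarrow> ('a \<Rightarrow> complex) set" where
  "characters H =
     hom ((units_of (ring_of_type_algebra :: 'a ring))\<lparr>carrier := H\<rparr>)
         (units_of (ring_of_type_algebra :: complex ring))"

definition trivial_on :: "'a :: finite_field set \<Rightarrow> ('a \<Rightarrow> complex) \<Rightarrow> bool" where
  "trivial_on H \<chi> \<longleftrightarrow> (\<forall>h\<in>H. \<chi> h = 1)"

definition chi_symmetric ::
    "'a :: finite_field set \<Rightarrow> ('a \<Rightarrow> complex) \<Rightarrow> ('a \<Rightarrow> complex) \<Rightarrow> bool" where
  "chi_symmetric H \<chi> f \<longleftrightarrow> (\<forall>h\<in>H. \<forall>a. f (h * a) = \<chi> h * f a)"

text \<open>
  The natural number subtractions do not truncate: \<open>CARD('a) \<ge> 2\<close>.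
\<close>
definition strong_uncertainty ::
    "'a :: finite_field set \<Rightarrow> ('a \<Rightarrow> complex) \<Rightarrow> bool" where
  "strong_uncertainty H \<chi> \<longleftrightarrow>
     (\<forall>f. f \<noteq> (\<lambda>_. 0) \<and> chi_symmetric H \<chi> f \<longrightarrow>
       card (supp f) + card (fourier_supp f) \<ge>
         (if \<not> trivial_on H \<chi> then CARD('a) + card H - 1
          else if f 0 = 0 \<and> fourier f (add_char 0) = 0 then CARD('a) + 2 * card H - 1
          else if f 0 = 0 \<or> fourier f (add_char 0) = 0 then CARD('a) + card H
          else CARD('a) + 1))"

end

theory Submission
  imports Defs
begin

text \<open>
  A function supported on \<open>H \<union> {0}\<close> with vanishing sum has a Fourier transform that vanishes at
  \<open>\<epsilon>\<^sub>b\<close> whenever \<open>\<epsilon>\<^sub>b\<close> is trivial on \<open>K \<supseteq> H\<close>. By orthogonality the annihilator of \<open>K\<close> in the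
  dual of \<open>F\<close> has at least \<open>q / |K| > 1\<close> elements. Hence extending \<open>\<chi>\<close> by zero from \<open>H\<close> to \<open>F\<close>
  and correcting its value at \<open>0\<close> to make the total sum vanish (a correction that is needed
  only for trivial \<open>\<chi>\<close>) gives a counterexample.
\<close>

lemma abs_trace_add: "abs_trace (x + y) = abs_trace x + abs_trace (y :: 'a :: finite_field)"
  unfolding abs_trace_def
  by (simp add: freshmans_dream' sum.distrib)

lemma of_nat_Least_abs_trace:
  "of_nat (LEAST k. of_nat k = abs_trace x) = abs_trace (x :: 'a :: finite_field)"
  using abs_trace_in_prime_field[of x] by (metis (mono_tags, lifting) LeastI)

text \<open>Makes the value of \<open>std_char\<close> independent of the representative that
  \<open>LEAST\<close> picks for the trace.\<close>

lemma exp_2_pi_i_cong: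
  assumes "[m = n] (mod p)" "p > 0"
  shows "exp (2 * of_real pi * \<i> * of_nat m / of_nat p) =
         exp (2 * of_real pi * \<i> * of_nat n / of_nat p :: complex)"
proof -
  have red: "exp (2 * of_real pi * \<i> * of_nat k / of_nat p) =
             exp (2 * of_real pi * \<i> * of_nat (k mod p) / of_nat p :: complex)" for k
  proof -
    have "(of_nat k :: complex) = of_nat (k div p) * of_nat p + of_nat (k mod p)"
      by (simp flip: of_nat_mult of_nat_add)
    hence "2 * of_real pi * \<i> * of_nat k / of_nat p =
           of_nat (k div p) * (2 * of_real pi * \<i>) +
           (2 * of_real pi * \<i> * of_nat (k mod p) / of_nat p :: complex)"
      using assms(2) by (simp add: field_simps)
    thus ?thesis
      by (simp only: exp_add exp_of_nat_mult exp_two_pi_i) simp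
  qed
  show ?thesis
    using assms(1) by (subst (1 2) red) (simp add: cong_def)
qed

text \<open>The least representatives of the traces add only modulo the characteristic, which the
  exponential does not see.\<close>

lemma std_char_add: "std_char (x + y) = std_char x * std_char (y :: 'a :: finite_field)"
proof -
  define r where "r = (\<lambda>x :: 'a. LEAST k. of_nat k = abs_trace x)"
  have "(of_nat (r (x + y)) :: 'a) = of_nat (r x + r y)"
    unfolding r_def of_nat_add of_nat_Least_abs_trace by (rule abs_trace_add)
  hence "[r (x + y) = r x + r y] (mod CHAR('a))"
    by (simp only: of_nat_eq_iff_cong_CHAR)
  hence "exp (2 * of_real pi * \<i> * of_nat (r (x + y)) / of_nat CHAR('a)) =
         exp (2 * of_real pi * \<i> * of_nat (r x + r y) / of_nat CHAR('a))"
    by (rule exp_2_pi_i_cong) simp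
  thus ?thesis
    unfolding std_char_def r_def
    by (simp add: exp_add ring_distribs add_divide_distrib)
qed

lemma std_char_0 [simp]: "std_char (0 :: 'a :: finite_field) = 1"
  \<comment> \<open>The value at 0 equals its own square, and it is nonzero as an
    exponential.\<close>
  using std_char_add[of 0 "0 :: 'a"] by (simp add: std_char_def)

text \<open>Translation by \<open>c\<close> permutes \<open>K\<close> and multiplies the sum by
  \<open>\<psi> c\<close>, which differs from 1.\<close>

lemma sum_character_eq_0:
  fixes \<psi> :: "'a :: ab_group_add \<Rightarrow> complex"
  assumes add: "\<And>x y. \<psi> (x + y) = \<psi> x * \<psi> y"
    and K: "\<And>x y. x \<in> K \<Longrightarrow> y \<in> K \<Longrightarrow> x + y \<in> K" "\<And>x. x \<in> K \<Longrightarrow> - x \<in> K"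
    and c: "c \<in> K" "\<psi> c \<noteq> 1"
  shows "(\<Sum>x\<in>K. \<psi> x) = 0"
proof -
  have "(\<Sum>x\<in>K. \<psi> x) = (\<Sum>x\<in>K. \<psi> (c + x))"
    by (rule sum.reindex_bij_witness[of _ "\<lambda>x. c + x" "\<lambda>x. - c + x"])
       (use K(1)[OF K(2)[OF c(1)]] K(1)[OF c(1)] in auto)
  also have "\<dots> = \<psi> c * (\<Sum>x\<in>K. \<psi> x)"
    by (simp add: add sum_distrib_left)
  finally show ?thesis using c by simp
qed

definition annihilator :: "'a :: finite_field set \<Rightarrow> 'a set" where
  "annihilator K = {b. \<forall>a\<in>K. add_char b a = 1}"

text \<open>Summing \<open>add_char b a\<close> over all \<open>b\<close> and all \<open>a\<close>
  in \<open>K\<close> in both orders gives q = |annihilator| |K|. As |K| < q, the first factor is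
  neither 0 nor 1.\<close>

lemma card_annihilator_ge_2:
  fixes K :: "'a :: finite_field set"
  assumes K: "\<And>x y. x \<in> K \<Longrightarrow> y \<in> K \<Longrightarrow> x + y \<in> K" "\<And>x. x \<in> K \<Longrightarrow> - x \<in> K"
    and "0 \<in> K" "K \<noteq> UNIV"
  shows "card (annihilator K) \<ge> 2"
\<comment> \<open>Treating the degenerate case separately spares a proof that the trace is not
  identically zero.\<close>
proof (cases "\<forall>x :: 'a. std_char x = 1")
  case True
  hence "annihilator K = UNIV"
    by (auto simp: annihilator_def add_char_def)
  moreover have "card {0 :: 'a, 1} \<le> CARD('a)"
    by (intro card_mono) auto
  ultimately show ?thesis by simp
next
  case False
  then obtain c :: 'a where c: "std_char c \<noteq> 1" by blast
  have col: "(\<Sum>b\<in>UNIV. add_char b a) = (if a = 0 then of_nat CARD('a) else 0)" for a :: 'a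
  proof (cases "a = 0")
    case False
    thus ?thesis
      \<comment> \<open>At \<open>c / a\<close> the character
        \<open>\<lambda>b. add_char b a\<close> takes the value \<open>std_char c\<close>, which is
        not 1.\<close>
      using c sum_character_eq_0[of "\<lambda>b. add_char b a" UNIV "c / a"]
      by (simp add: add_char_def std_char_add ring_distribs)
  qed (simp add: add_char_def)
  have row: "(\<Sum>a\<in>K. add_char b a) = (if b \<in> annihilator K then of_nat (card K) else 0)" for b
  proof (cases "b \<in> annihilator K")
    case False
    thus ?thesis
      using sum_character_eq_0[of "add_char b" K] K
      by (auto simp: annihilator_def add_char_def std_char_add ring_distribs)
  qed (simp add: annihilator_def)
  have "of_nat CARD('a) = (\<Sum>a\<in>K. \<Sum>b\<in>UNIV. add_char b a)"
    using \<open>0 \<in> K\<close> by (simp add: col)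
  also have "\<dots> = (\<Sum>b\<in>UNIV. \<Sum>a\<in>K. add_char b a)"
    by (rule sum.swap)
  also have "\<dots> = of_nat (card (annihilator K) * card K)"
    by (simp add: row sum.If_cases)
  finally have "CARD('a) = card (annihilator K) * card K"
    by (simp only: of_nat_eq_iff)
  moreover have "card K < CARD('a)"
    using \<open>K \<noteq> UNIV\<close> by (intro psubset_card_mono) auto
  ultimately have "card (annihilator K) \<noteq> 0" "card (annihilator K) \<noteq> 1"
    by auto
  thus ?thesis by linarith
qed

text \<open>The support consists of characters with index outside \<open>B\<close>, and passing from
  indices to characters cannot increase the cardinality.\<close>

lemma card_fourier_supp_le:
  fixes f :: "'a :: finite_field \<Rightarrow> complex"
  assumes "\<And>b. b \<in> B \<Longrightarrow> fourier f (add_char b) = 0"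
  shows "card (fourier_supp f) + card B \<le> CARD('a)"
proof -
  have "fourier_supp f \<subseteq> add_char ` (- B)"
    using assms by (auto simp: fourier_supp_def dual_def)
  hence "card (fourier_supp f) \<le> card (- B)"
    by (meson card_image_le card_mono finite finite_imageI le_trans)
  thus ?thesis
    using card_mono[of UNIV B] by (simp add: card_Diff_subset Compl_eq_Diff_UNIV)
qed

lemma Units_ring_of_type_algebra:
  "Units (ring_of_type_algebra :: 'a :: field ring) = - {0}"
  by (auto simp: Units_def ring_of_type_algebra_def intro: left_inverse right_inverse)

theorem theorem6p1:
  fixes H K :: "'a :: finite_field set" and \<chi> :: "'a \<Rightarrow> complex"
  assumes "subgroup H (units_of (ring_of_type_algebra :: 'a ring))"
    and "subfield K (ring_of_type_algebra :: 'a ring)" and "K \<noteq> UNIV" and "H \<subseteq> K"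
    and "\<chi> \<in> characters H"
  shows "\<not> strong_uncertainty H \<chi>"
proof
  assume su: "strong_uncertainty H \<chi>"
  let ?R = "ring_of_type_algebra :: 'a ring"
  interpret R: field ?R by rule
  note K = subringE[OF subfieldE(1)[OF assms(2)]]
  have mult: "(\<otimes>\<^bsub>units_of ?R\<^esub>) = (*)" and one: "\<one>\<^bsub>units_of ?R\<^esub> = 1"
    by (auto simp: units_of_def ring_of_type_algebra_def)
  have H1: "1 \<in> H"
    using subgroup.one_closed[OF assms(1)] by (simp add: one)
  have H_mult: "x * y \<in> H" if "x \<in> H" "y \<in> H" for x y
    using subgroup.m_closed[OF assms(1) that] by (simp add: mult)
  have H0: "0 \<notin> H"
    using subgroup.subset[OF assms(1)] by (auto simp: units_of_def Units_ring_of_type_algebra)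
  \<comment> \<open>Multiplication by \<open>h\<close> preserves both \<open>H\<close> and its
    complement, so extending by zero keeps the symmetry.\<close>
  have H_div: "h * a \<in> H \<longleftrightarrow> a \<in> H" if h: "h \<in> H" for h a
  proof
    assume "h * a \<in> H"
    interpret G: group "units_of ?R" by (rule R.units_group)
    define g where "g = inv\<^bsub>units_of ?R\<^esub> h"
    have g: "g * h = 1" "g \<in> H"
      using G.l_inv[of h] subgroup.m_inv_closed[OF assms(1) h] subgroup.subset[OF assms(1)] h
      by (auto simp: g_def one mult)
    have "g * (h * a) = a"
      using g(1) by (simp flip: mult.assoc)
    thus "a \<in> H"
      using H_mult[OF g(2) \<open>h * a \<in> H\<close>] by (simp only:)
  qed (use h H_mult in auto)
  have chi_mult: "\<chi> (x * y) = \<chi> x * \<chi> y" if "x \<in> H" "y \<in> H" for x y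
    using assms(5) that unfolding characters_def hom_def
    by (auto simp: units_of_def ring_of_type_algebra_def)
  have chi_nz: "\<chi> x \<noteq> 0" if "x \<in> H" for x
    using assms(5) that unfolding characters_def hom_def
    by (auto simp: units_of_def Units_ring_of_type_algebra)
  have K0: "0 \<in> K"
    using K(2) by (simp add: ring_of_type_algebra_def)
  have K_add: "x + y \<in> K" if "x \<in> K" "y \<in> K" for x y
    using K(7)[OF that] by (simp add: ring_of_type_algebra_def)
  have K_minus: "- x \<in> K" if "x \<in> K" for x
  proof -
    have "\<ominus>\<^bsub>?R\<^esub> x = - x"
      by (rule R.minus_equality) (auto simp: ring_of_type_algebra_def)
    thus ?thesis
      using K(5)[OF that] by simp
  qed

  define s where "s = (\<Sum>h\<in>H. \<chi> h)"
  \<comment> \<open>This serves twice: it makes the value \<open>- s\<close> at the fixed point 0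
    compatible with symmetry, and it forces \<open>s = 0\<close> for nontrivial
    \<open>\<chi>\<close>.\<close>
  have s: "\<chi> h * s = s" if "h \<in> H" for h
  proof -
    have "h \<noteq> 0"
      using that H0 by auto
    hence div: "a / h \<in> H" if "a \<in> H" for a
      using H_div[OF \<open>h \<in> H\<close>, of "a / h"] that by simp
    have "s = (\<Sum>a\<in>H. \<chi> (h * a))"
      unfolding s_def
      by (rule sum.reindex_bij_witness[of _ "\<lambda>a. h * a" "\<lambda>a. a / h"])
         (simp_all add: \<open>h \<noteq> 0\<close> div H_mult that)
    also have "\<dots> = \<chi> h * s"
      by (simp add: s_def sum_distrib_left chi_mult that)
    finally show ?thesis ..
  qed
  define f where "f = (\<lambda>a. if a \<in> H then \<chi> a else if a = 0 then - s else 0)"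
  have f_nz: "f \<noteq> (\<lambda>_. 0)"
    using H1 chi_nz[OF H1] by (auto simp: f_def fun_eq_iff intro!: exI[of _ 1])
  have f_sym: "chi_symmetric H \<chi> f"
    using H0 by (auto simp: chi_symmetric_def f_def H_div chi_mult s)
  have fourier_f: "fourier f (add_char b) = 0" if "b \<in> annihilator K" for b
  proof -
    have "fourier f (add_char b) = (\<Sum>a\<in>insert 0 H. f a * add_char b a)"
      unfolding fourier_def by (rule sum.mono_neutral_right) (auto simp: f_def)
    also have "\<dots> = (\<Sum>a\<in>insert 0 H. f a)"
      using that K0 \<open>H \<subseteq> K\<close> by (intro sum.cong) (auto simp: annihilator_def)
    also have "\<dots> = 0"
      using H0 by (simp add: f_def s_def)
    finally show ?thesis .
  qed
  note ineq = su[unfolded strong_uncertainty_def, rule_format, OF conjI[OF f_nz f_sym]]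
  \<comment> \<open>The trivial character alone would leave q - 1 for the Fourier support, which
    does not contradict the bounds; the second element decides.\<close>
  have "card (annihilator K) \<ge> 2"
    by (rule card_annihilator_ge_2) (use K0 K_add K_minus \<open>K \<noteq> UNIV\<close> in auto)
  moreover have "card (fourier_supp f) + card (annihilator K) \<le> CARD('a)"
    by (rule card_fourier_supp_le) (rule fourier_f)
  ultimately have fs: "card (fourier_supp f) + 2 \<le> CARD('a)"
    by linarith
  show False
  proof (cases "trivial_on H \<chi>")
    case True
    hence "s = of_nat (card H)"
      by (simp add: s_def trivial_on_def)
    \<comment> \<open>Exactly one of the two values at 0 vanishes, so the bound in force is q + |H|,
      while the supports total at most (|H| + 1) + (q - 2).\<close>
    hence "f 0 \<noteq> 0"
      using H0 H1 by (auto simp: f_def)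
    moreover have "fourier f (add_char 0) = 0"
      by (rule fourier_f) (simp add: annihilator_def add_char_def)
    ultimately have "CARD('a) + card H \<le> card (supp f) + card (fourier_supp f)"
      using ineq True by simp
    moreover have "card (supp f) \<le> card (insert 0 H)"
      by (rule card_mono) (auto simp: supp_def f_def split: if_splits)
    ultimately show False
      using fs H0 by simp
  next
    case False
    then obtain h where "h \<in> H" "\<chi> h \<noteq> 1"
      by (auto simp: trivial_on_def)
    \<comment> \<open>Now 0 leaves the support of \<open>f\<close>, and the total is at most |H| +
      (q - 2), one below the bound.\<close>
    hence "s = 0"
      using s by fastforce
    hence "card (supp f) \<le> card H"
      by (intro card_mono) (auto simp: supp_def f_def split: if_splits)
    moreover have "CARD('a) + card H - 1 \<le> card (supp f) + card (fourier_supp f)"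
      using ineq False by simp
    ultimately show False
      using fs by linarith
  qed
qed

end
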